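(* Let $\alpha>0$, $\beta>0$ and $\mathbf{X}\in\mathbb{T}_{\alpha\beta}^{p\times q}$. Let $\mathbf{X}=\sum_{i=1}^r\sigma_i\mathbf{u}(i)\mathbf{v}^{\mathtt{H}_1^1}(i)$ be the ordered SVD of $\mathbf{X}$ and, for $k\le r$, let $\mathbf{X}_k=\sum_{i=1}^k\sigma_i\mathbf{u}(i)\mathbf{v}^{\mathtt{H}_1^1}(i)$. Let $\check{\mathbf{X}}_k=\sum_{i=1}^k\check\sigma_i\check{\mathbf{u}}(i)\check{\mathbf{v}}^{\mathtt{H}_1^1}(i)$ be the truncation of any SVD of $\mathbf{X}$ obtained by four permutations $\tau_1,\dots,\tau_4$ of the singular values, all as defined in the context. Then: 1. $\langle\mathbf{X},\mathbf{X}\rangle_1=\sum_{i=1}^r\sigma_i^2$. 2. $\langle\mathbf{X}-\mathbf{X}_k,\mathbf{X}-\mathbf{X}_k\rangle_1=\sum_{i=k+1}^r\sigma_i^2$. 3. $\langle\mathbf{X}-\mathbf{X}_k,\mathbf{X}-\mathbf{X}_k\rangle_1\preceq\langle\mathbf{X}-\check{\mathbf{X}}_k,\mathbf{X}-\check{\mathbf{X}}_k\rangle_1$. 4. $\|\mathbf{X}-\mathbf{X}_k\|_1\le\|\mathbf{X}-\check{\mathbf{X}}_k\|_1$.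
   Context: $\mathbb{T}_{\alpha\beta}$ (the $(\alpha\beta)$-tessarines) is the commutative, associative real algebra with basis $1,\mathrm{i},\mathrm{j},\mathrm{k}$ and multiplication $\mathrm{i}^2=\alpha$, $\mathrm{j}^2=\beta$, $\mathrm{k}^2=\alpha\beta$, $\mathrm{i}\mathrm{j}=\mathrm{k}$, $\mathrm{i}\mathrm{k}=\alpha\mathrm{j}$, $\mathrm{j}\mathrm{k}=\beta\mathrm{i}$. Here $\mathbf{X}^{\mathtt{H}_1^1}=\mathbf{X}^{\mathtt T}$, $\langle\mathbf{X},\mathbf{Y}\rangle_1=\mathrm{trace}(\mathbf{X}^{\mathtt{H}_1^1}\mathbf{Y})\in\mathbb{T}_{\alpha\beta}$ and $\|\mathbf{X}\|_1=\Re\{\langle\mathbf{X},\mathbf{X}\rangle_1\}^{1/2}$, where $\Re$ is the coefficient of $1$. Associated tessarine ($\alpha>0$): $\tilde x=\tilde a+\tilde b\mathrm{i}+\tilde c\mathrm{j}+\tilde d\mathrm{k}$ is the associated $(\alpha\beta)$-tessarine of $x$ if $x=\frac{\tilde a+\tilde b+\tilde c+\tilde d}{4}+\frac{\tilde a-\tilde b+\tilde c-\tilde d}{4\sqrt\alpha}\mathrm{i}+\frac{\tilde a+\tilde b-\tilde c-\tilde d}{4\sqrt\beta}\mathrm{j}+\frac{\tilde a-\tilde b-\tilde c+\tilde d}{4\sqrt\alpha\sqrt\beta}\mathrm{k}$; for matrices it is defined entrywise. $x$ is semipositive if all four components of $\tilde x$ are $\ge0$; $x\preceq y$ means $y-x$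 is semipositive. For $\mathbf{X}=\mathbf{A}+\mathbf{B}\mathrm{i}+\mathbf{C}\mathrm{j}+\mathbf{D}\mathrm{k}$ put $\mathbf{A}_1=\mathbf{A}+\sqrt\alpha\mathbf{B}+\sqrt\beta\mathbf{C}+\sqrt{\alpha\beta}\mathbf{D}$, $\mathbf{A}_2=\mathbf{A}-\sqrt\alpha\mathbf{B}+\sqrt\beta\mathbf{C}-\sqrt{\alpha\beta}\mathbf{D}$, $\mathbf{A}_3=\mathbf{A}+\sqrt\alpha\mathbf{B}-\sqrt\beta\mathbf{C}-\sqrt{\alpha\beta}\mathbf{D}$, $\mathbf{A}_4=\mathbf{A}-\sqrt\alpha\mathbf{B}-\sqrt\beta\mathbf{C}+\sqrt{\alpha\beta}\mathbf{D}$ (so the associated matrix of $\mathbf{X}$ is $\mathbf{A}_1+\mathbf{A}_2\mathrm{i}+\mathbf{A}_3\mathrm{j}+\mathbf{A}_4\mathrm{k}$). Let $\mathbf{A}_n=\mathbf{U}_n\boldsymbol\Sigma_n\mathbf{V}_n^{\mathtt T}$ be real SVDs ($\mathbf{U}_n\in\mathbb{R}^{p\times p}$, $\mathbf{V}_n\in\mathbb{R}^{q\times q}$ orthogonal) with nonzero singular values $\sigma_{n1}\ge\sigma_{n2}\ge\dots\ge\sigma_{nr_n}$ in the first $r_n$ diagonal positions of $\boldsymbol\Sigma_n$, and put $\sigma_{ni}=0$ for $i>r_n$, $r=\max(r_1,r_2,r_3,r_4)$. Ordered SVD: $\mathbf{X}=\mathbf{U}\boldsymbol\Sigma\mathbf{V}^{\mathtt{H}_1^1}$,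 where $\mathbf{U},\boldsymbol\Sigma,\mathbf{V}$ are the matrices over $\mathbb{T}_{\alpha\beta}$ with associated matrices $\mathbf{U}_1+\mathbf{U}_2\mathrm{i}+\mathbf{U}_3\mathrm{j}+\mathbf{U}_4\mathrm{k}$, $\boldsymbol\Sigma_1+\boldsymbol\Sigma_2\mathrm{i}+\boldsymbol\Sigma_3\mathrm{j}+\boldsymbol\Sigma_4\mathrm{k}$, $\mathbf{V}_1+\mathbf{V}_2\mathrm{i}+\mathbf{V}_3\mathrm{j}+\mathbf{V}_4\mathrm{k}$; $\sigma_i$ is the $(i,i)$ entry of $\boldsymbol\Sigma$ (with associated tessarine $\sigma_{1i}+\sigma_{2i}\mathrm{i}+\sigma_{3i}\mathrm{j}+\sigma_{4i}\mathrm{k}$), and $\mathbf{u}(i),\mathbf{v}(i)$ are the $i$th columns of $\mathbf{U},\mathbf{V}$. Permuted SVD: for permutations $\tau_n$ of the singular values $\{\sigma_{ni}\}_{i=1}^{r_n}$, $n=1,\dots,4$, reorder for each $n$ the first $r_n$ diagonal entries of $\boldsymbol\Sigma_n$ and correspondingly the first $r_n$ columns of $\mathbf{U}_n$ and $\mathbf{V}_n$ by $\tau_n$, and form from these, in the same way, $\mathbf{X}=\check{\mathbf{U}}\check{\boldsymbol\Sigma}\check{\mathbf{V}}^{\mathtt{H}_1^1}$; $\check\sigma_i,\check{\mathbf{u}}(i),\check{\mathbf{v}}(i)$ are the $(i,i)$ entry of $\check{\boldsymbol\Sigma}$ and the $i$th columns of $\check{\mathbf{U}},\check{\mathbf{V}}$.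 *)

theory Defs
  imports
    "Jordan_Normal_Form.Matrix"
    "HOL-Combinatorics.Permutations"
begin

datatype tessarine = Tess (t_re: real) (t_i: real) (t_j: real) (t_k: real)

lemma tessarine_eqI:
  "\<lbrakk>t_re x = t_re y; t_i x = t_i y; t_j x = t_j y; t_k x = t_k y\<rbrakk> \<Longrightarrow> x = y"
  by (cases x; cases y) simp

instantiation tessarine :: ab_group_add
begin

definition "0 = Tess 0 0 0 0"
definition "x + y = Tess (t_re x + t_re y) (t_i x + t_i y) (t_j x + t_j y) (t_k x + t_k y)"
definition "- x = Tess (- t_re x) (- t_i x) (- t_j x) (- t_k x)"
definition "x - y = Tess (t_re x - t_re y) (t_i x - t_i y) (t_j x - t_j y) (t_k x - t_k y)"

instance
  by standard (simp_all add: zero_tessarine_def plus_tessarine_def uminus_tessarine_def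
      minus_tessarine_def tessarine.expand)

end

text \<open>
  The additive group does not depend on the parameters, so it is a class instance.  The product
  depends on the reals \<open>\<alpha>\<close> and \<open>\<beta>\<close> and is therefore an ordinary function
  that takes them as arguments; the same holds for everything built on it.
\<close>

definition tmult :: "real \<Rightarrow> real \<Rightarrow> tessarine \<Rightarrow> tessarine \<Rightarrow> tessarine" where
  "tmult \<alpha> \<beta> x y = Tess
     (t_re x * t_re y + \<alpha> * t_i x * t_i y + \<beta> * t_j x * t_j y + \<alpha> * \<beta> * t_k x * t_k y)
     (t_re x * t_i y + t_i x * t_re y + \<beta> * (t_j x * t_k y + t_k x * t_j y))
     (t_re x * t_j y + t_j x * t_re y + \<alpha> * (t_i x * t_k y + t_k x * t_i y))
     (t_re x * t_k y + t_k x * t_re y + t_i x * t_j y + t_j x * t_i y)"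

definition tscale :: "real \<Rightarrow> tessarine \<Rightarrow> tessarine" where
  "tscale c x = Tess (c * t_re x) (c * t_i x) (c * t_j x) (c * t_k x)"

lemma tmult_table:
  fixes \<alpha> \<beta> :: real
  defines "e \<equiv> Tess 1 0 0 0" and "i \<equiv> Tess 0 1 0 0"
    and "j \<equiv> Tess 0 0 1 0" and "k \<equiv> Tess 0 0 0 1"
  shows "tmult \<alpha> \<beta> e x = x"
    and "tmult \<alpha> \<beta> i i = tscale \<alpha> e"
    and "tmult \<alpha> \<beta> j j = tscale \<beta> e"
    and "tmult \<alpha> \<beta> k k = tscale (\<alpha> * \<beta>) e"
    and "tmult \<alpha> \<beta> i j = k"
    and "tmult \<alpha> \<beta> i k = tscale \<alpha> j"
    and "tmult \<alpha> \<beta> j k = tscale \<beta> i"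
  by (simp_all add: assms tmult_def tscale_def)

lemma tmult_commute: "tmult \<alpha> \<beta> x y = tmult \<alpha> \<beta> y x"
  by (simp add: tmult_def algebra_simps)

lemma tmult_assoc: "tmult \<alpha> \<beta> (tmult \<alpha> \<beta> x y) z = tmult \<alpha> \<beta> x (tmult \<alpha> \<beta> y z)"
  by (simp add: tmult_def algebra_simps)

lemma tmult_add_left: "tmult \<alpha> \<beta> (x + y) z = tmult \<alpha> \<beta> x z + tmult \<alpha> \<beta> y z"
  by (simp add: tmult_def plus_tessarine_def algebra_simps)

lemma tmult_scale_left: "tmult \<alpha> \<beta> (tscale c x) y = tscale c (tmult \<alpha> \<beta> x y)"
  by (simp add: tmult_def tscale_def algebra_simps)

definition tmat_mult ::
    "real \<Rightarrow> real \<Rightarrow> tessarine mat \<Rightarrow> tessarine mat \<Rightarrow> tessarine mat" where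
  "tmat_mult \<alpha> \<beta> M N =
     mat (dim_row M) (dim_col N)
       (\<lambda>(i, j). \<Sum>l<dim_row N. tmult \<alpha> \<beta> (M $$ (i, l)) (N $$ (l, j)))"

definition herm11 :: "tessarine mat \<Rightarrow> tessarine mat" where
  "herm11 M = transpose_mat M"

definition tmat_trace :: "tessarine mat \<Rightarrow> tessarine" where
  "tmat_trace M = (\<Sum>i<dim_row M. M $$ (i, i))"

definition inner1 :: "real \<Rightarrow> real \<Rightarrow> tessarine mat \<Rightarrow> tessarine mat \<Rightarrow> tessarine" where
  "inner1 \<alpha> \<beta> M N = tmat_trace (tmat_mult \<alpha> \<beta> (herm11 M) N)"

definition norm1 :: "real \<Rightarrow> real \<Rightarrow> tessarine mat \<Rightarrow> real" where
  "norm1 \<alpha> \<beta> M = sqrt (t_re (inner1 \<alpha> \<beta> M M))"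

text \<open>\<open>of_assoc \<alpha> \<beta> xt\<close> is the tessarine whose associated tessarine is \<open>xt\<close>.\<close>

definition of_assoc :: "real \<Rightarrow> real \<Rightarrow> tessarine \<Rightarrow> tessarine" where
  "of_assoc \<alpha> \<beta> xt = Tess
     ((t_re xt + t_i xt + t_j xt + t_k xt) / 4)
     ((t_re xt - t_i xt + t_j xt - t_k xt) / (4 * sqrt \<alpha>))
     ((t_re xt + t_i xt - t_j xt - t_k xt) / (4 * sqrt \<beta>))
     ((t_re xt - t_i xt - t_j xt + t_k xt) / (4 * sqrt \<alpha> * sqrt \<beta>))"

definition is_assoc :: "real \<Rightarrow> real \<Rightarrow> tessarine \<Rightarrow> tessarine \<Rightarrow> bool" where
  "is_assoc \<alpha> \<beta> xt x \<longleftrightarrow> x = of_assoc \<alpha> \<beta> xt"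

definition semipositive :: "real \<Rightarrow> real \<Rightarrow> tessarine \<Rightarrow> bool" where
  "semipositive \<alpha> \<beta> x \<longleftrightarrow>
     (\<exists>xt. is_assoc \<alpha> \<beta> xt x \<and> t_re xt \<ge> 0 \<and> t_i xt \<ge> 0 \<and> t_j xt \<ge> 0 \<and> t_k xt \<ge> 0)"

definition tess_le :: "real \<Rightarrow> real \<Rightarrow> tessarine \<Rightarrow> tessarine \<Rightarrow> bool" where
  "tess_le \<alpha> \<beta> x y \<longleftrightarrow> semipositive \<alpha> \<beta> (y - x)"

lemma is_assoc_ex1:
  assumes "\<alpha> > 0" "\<beta> > 0"
  shows "\<exists>!xt. is_assoc \<alpha> \<beta> xt x"
proof
  let ?xt = "Tess (t_re x + sqrt \<alpha> * t_i x + sqrt \<beta> * t_j x + sqrt \<alpha> * sqrt \<beta> * t_k x)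
     (t_re x - sqrt \<alpha> * t_i x + sqrt \<beta> * t_j x - sqrt \<alpha> * sqrt \<beta> * t_k x)
     (t_re x + sqrt \<alpha> * t_i x - sqrt \<beta> * t_j x - sqrt \<alpha> * sqrt \<beta> * t_k x)
     (t_re x - sqrt \<alpha> * t_i x - sqrt \<beta> * t_j x + sqrt \<alpha> * sqrt \<beta> * t_k x)"
  show "is_assoc \<alpha> \<beta> ?xt x"
    using assms by (cases x) (simp add: is_assoc_def of_assoc_def field_simps)
  show "xt = ?xt" if "is_assoc \<alpha> \<beta> xt x" for xt
    using that assms by (cases xt) (simp add: is_assoc_def of_assoc_def field_simps)
qed

text \<open>
  Families of four real matrices are functions on \<open>nat\<close>, used at the indices
  \<open>1, 2, 3, 4\<close> only.  \<open>tess_mat M\<close> is \<open>M 1 + M 2 i + M 3 j + M 4 k\<close>, and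
  \<open>mat_of_assoc \<alpha> \<beta> M\<close> is the matrix whose associated matrix is \<open>tess_mat M\<close>.
\<close>

definition tess_mat :: "(nat \<Rightarrow> real mat) \<Rightarrow> tessarine mat" where
  "tess_mat M = mat (dim_row (M 1)) (dim_col (M 1))
     (\<lambda>ij. Tess (M 1 $$ ij) (M 2 $$ ij) (M 3 $$ ij) (M 4 $$ ij))"

definition mat_of_assoc :: "real \<Rightarrow> real \<Rightarrow> (nat \<Rightarrow> real mat) \<Rightarrow> tessarine mat" where
  "mat_of_assoc \<alpha> \<beta> M = map_mat (of_assoc \<alpha> \<beta>) (tess_mat M)"

definition assoc_part :: "real \<Rightarrow> real \<Rightarrow> tessarine mat \<Rightarrow> nat \<Rightarrow> real mat" where
  "assoc_part \<alpha> \<beta> X n =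
     (let A = map_mat t_re X; B = sqrt \<alpha> \<cdot>\<^sub>m map_mat t_i X;
          C = sqrt \<beta> \<cdot>\<^sub>m map_mat t_j X; D = sqrt (\<alpha> * \<beta>) \<cdot>\<^sub>m map_mat t_k X
      in if n = 1 then A + B + C + D
         else if n = 2 then A - B + C - D
         else if n = 3 then A + B - C - D
         else A - B - C + D)"

lemma mat_of_assoc_assoc_part:
  assumes "\<alpha> > 0" "\<beta> > 0"
  shows "mat_of_assoc \<alpha> \<beta> (assoc_part \<alpha> \<beta> X) = X"
  by (rule eq_matI)
    (use assms in \<open>auto simp: mat_of_assoc_def tess_mat_def assoc_part_def Let_def of_assoc_def
        real_sqrt_mult field_simps intro!: tessarine_eqI\<close>)

text \<open>
  The library predicate \<open>orthogonal_mat\<close> only demands pairwise orthogonal nonzero columns,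
  without normalisation.
\<close>

definition orthonormal_mat :: "nat \<Rightarrow> real mat \<Rightarrow> bool" where
  "orthonormal_mat n U \<longleftrightarrow>
     U \<in> carrier_mat n n \<and> transpose_mat U * U = 1\<^sub>m n \<and> U * transpose_mat U = 1\<^sub>m n"

text \<open>
  \<open>A = U S V\<^sup>T\<close> is a full singular value decomposition of the real \<open>p \<times> q\<close> matrix
  \<open>A\<close> with exactly \<open>r\<close> nonzero singular values, which are in weakly decreasing order.
  Indices are zero-based: the \<open>i\<close>-th singular value of the usual numbering
  is \<open>S $$ (i - 1, i - 1)\<close>.
\<close>

definition real_svd ::
    "nat \<Rightarrow> nat \<Rightarrow> real mat \<Rightarrow> real mat \<Rightarrow> real mat \<Rightarrow> real mat \<Rightarrow> nat \<Rightarrow> bool" where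
  "real_svd p q A U S V r \<longleftrightarrow>
     orthonormal_mat p U \<and> orthonormal_mat q V \<and>
     S \<in> carrier_mat p q \<and> diagonal_mat S \<and>
     A = U * S * transpose_mat V \<and>
     r \<le> min p q \<and>
     (\<forall>i<r. S $$ (i, i) > 0) \<and>
     (\<forall>i. r \<le> i \<and> i < min p q \<longrightarrow> S $$ (i, i) = 0) \<and>
     (\<forall>i j. i \<le> j \<and> j < r \<longrightarrow> S $$ (j, j) \<le> S $$ (i, i))"

text \<open>
  Reorderings by \<open>\<tau>\<close>, which is only used when it permutes \<open>{..<r}\<close>: positions
  beyond the first \<open>r\<close> are then unaffected.
\<close>

definition reorder_cols :: "(nat \<Rightarrow> nat) \<Rightarrow> real mat \<Rightarrow> real mat" where
  "reorder_cols \<tau> U = mat (dim_row U) (dim_col U) (\<lambda>(i, j). U $$ (i, \<tau> j))"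

definition reorder_diag :: "(nat \<Rightarrow> nat) \<Rightarrow> real mat \<Rightarrow> real mat" where
  "reorder_diag \<tau> S =
     mat (dim_row S) (dim_col S) (\<lambda>(i, j). if i = j then S $$ (\<tau> i, \<tau> i) else S $$ (i, j))"

definition col_mat :: "tessarine mat \<Rightarrow> nat \<Rightarrow> tessarine mat" where
  "col_mat M i = mat_of_cols (dim_row M) [col M i]"

text \<open>The sum of the first \<open>k\<close> terms \<open>\<sigma>\<^sub>i u(i) v(i)\<^sup>H\<close>, written entrywise.\<close>

definition svd_trunc ::
    "real \<Rightarrow> real \<Rightarrow> tessarine mat \<Rightarrow> tessarine mat \<Rightarrow> tessarine mat \<Rightarrow> nat \<Rightarrow> tessarine mat" where
  "svd_trunc \<alpha> \<beta> U S V k =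
     mat (dim_row U) (dim_row V) (\<lambda>lm. \<Sum>i<k. tmult \<alpha> \<beta> (S $$ (i, i))
       (tmat_mult \<alpha> \<beta> (col_mat U i) (herm11 (col_mat V i)) $$ lm))"

end

theory Submission
  imports Defs
begin

text \<open>
  For \<open>\<alpha>, \<beta> > 0\<close> the four components of the associated tessarine are algebra homomorphisms
  to the reals, and jointly they are injective: the algebra is a product of four copies of the
  reals. Under the \<open>n\<close>-th component \<open>inner1 \<alpha> \<beta> M M\<close> becomes the squared Frobenius norm
  of the real matrix \<open>assoc_part \<alpha> \<beta> M n\<close>, and an SVD truncation becomes a truncation of
  the \<open>n\<close>-th real SVD. Orthonormality gives the squared error as the sum of the squares of the
  omitted singular values, and this is smallest if the largest ones are kept.
\<close>

section \<open>Components of the associated tessarine as evaluations\<close>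

text \<open>Evaluation of i, j, k at signed square roots: i and j take the signs (+,+), (-,+),
  (+,-), (-,-) for n = 1, 2, 3, 4, and k takes their product.\<close>

definition assoc_comp :: "real \<Rightarrow> real \<Rightarrow> nat \<Rightarrow> tessarine \<Rightarrow> real" where
  "assoc_comp \<alpha> \<beta> n x =
     (let b = sqrt \<alpha> * t_i x; c = sqrt \<beta> * t_j x; d = sqrt \<alpha> * sqrt \<beta> * t_k x
      in if n = 1 then t_re x + b + c + d
         else if n = 2 then t_re x - b + c - d
         else if n = 3 then t_re x + b - c - d
         else t_re x - b - c + d)"

lemma assoc_comp_zero [simp]: "assoc_comp \<alpha> \<beta> n 0 = 0"
  by (simp add: assoc_comp_def Let_def zero_tessarine_def)

lemma assoc_comp_add: "assoc_comp \<alpha> \<beta> n (x + y) = assoc_comp \<alpha> \<beta> n x + assoc_comp \<alpha> \<beta> n y"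
  by (simp add: assoc_comp_def Let_def plus_tessarine_def algebra_simps)

lemma assoc_comp_diff: "assoc_comp \<alpha> \<beta> n (x - y) = assoc_comp \<alpha> \<beta> n x - assoc_comp \<alpha> \<beta> n y"
  by (simp add: assoc_comp_def Let_def minus_tessarine_def algebra_simps)

lemma assoc_comp_sum: "assoc_comp \<alpha> \<beta> n (sum f I) = (\<Sum>i\<in>I. assoc_comp \<alpha> \<beta> n (f i))"
  by (induction I rule: infinite_finite_induct) (simp_all add: assoc_comp_add)

text \<open>The values assigned to i, j and k satisfy the multiplication table, so each evaluation
  respects products. The default branch is such an evaluation too, hence no restriction on
  \<open>n\<close>.\<close>

lemma assoc_comp_tmult:
  assumes "\<alpha> \<ge> 0" "\<beta> \<ge> 0"
  shows "assoc_comp \<alpha> \<beta> n (tmult \<alpha> \<beta> x y) = assoc_comp \<alpha> \<beta> n x * assoc_comp \<alpha> \<beta> n y"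
proof -
  \<comment> \<open>With \<alpha> and \<beta> written as squares the roots simplify away, leaving a
    polynomial identity.\<close>
  obtain a b where "a \<ge> 0" "b \<ge> 0" "\<alpha> = a * a" "\<beta> = b * b"
    using assms by (metis real_sqrt_ge_zero real_sqrt_mult_self abs_of_nonneg)
  then show ?thesis
    by (simp add: assoc_comp_def Let_def tmult_def algebra_simps)
qed

lemma assoc_comp_of_assoc:
  assumes "\<alpha> > 0" "\<beta> > 0" "n \<in> {1..4}"
  shows "assoc_comp \<alpha> \<beta> n (of_assoc \<alpha> \<beta> (Tess (f 1) (f 2) (f 3) (f 4))) = f n"
proof -
  have "n = 1 \<or> n = 2 \<or> n = 3 \<or> n = 4"
    using assms by auto
  then show ?thesis
    using assms by (auto simp: assoc_comp_def Let_def of_assoc_def field_simps)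
qed

lemma of_assoc_assoc_comp:
  assumes "\<alpha> > 0" "\<beta> > 0"
  shows "of_assoc \<alpha> \<beta> (Tess (assoc_comp \<alpha> \<beta> 1 x) (assoc_comp \<alpha> \<beta> 2 x)
    (assoc_comp \<alpha> \<beta> 3 x) (assoc_comp \<alpha> \<beta> 4 x)) = x"
  using assms
  by (intro tessarine_eqI) (auto simp: assoc_comp_def Let_def of_assoc_def field_simps)

text \<open>Joint injectivity: \<open>of_assoc\<close> recovers a tessarine from its four
  components. Equations between tessarines thereby reduce to real ones.\<close>

lemma assoc_comp_eqI:
  assumes "\<alpha> > 0" "\<beta> > 0"
    and "\<And>n. n \<in> {1..4} \<Longrightarrow> assoc_comp \<alpha> \<beta> n x = assoc_comp \<alpha> \<beta> n y"
  shows "x = y"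
  using of_assoc_assoc_comp[OF assms(1,2), of x] of_assoc_assoc_comp[OF assms(1,2), of y] assms(3)
  by simp

lemma semipositiveI:
  assumes "\<alpha> > 0" "\<beta> > 0"
    and "\<And>n. n \<in> {1..4} \<Longrightarrow> assoc_comp \<alpha> \<beta> n x \<ge> 0"
  shows "semipositive \<alpha> \<beta> x"
  unfolding semipositive_def is_assoc_def
  using assms(3) of_assoc_assoc_comp[OF assms(1,2), of x, symmetric]
  by (intro exI conjI) auto

text \<open>The real part is a quarter of the sum of the associated components. This carries the
  order on tessarines over to the norms.\<close>

lemma semipositive_imp_t_re_nonneg: "semipositive \<alpha> \<beta> x \<Longrightarrow> t_re x \<ge> 0"
  by (auto simp: semipositive_def is_assoc_def of_assoc_def)

section \<open>From tessarine matrices to their four real matrices\<close>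

lemma assoc_part_index:
  assumes "X \<in> carrier_mat p q" "l < p" "m < q"
  shows "assoc_part \<alpha> \<beta> X n $$ (l, m) = assoc_comp \<alpha> \<beta> n (X $$ (l, m))"
  using assms by (simp add: assoc_part_def assoc_comp_def Let_def real_sqrt_mult)

lemma mat_of_assoc_carrier: "M 1 \<in> carrier_mat p q \<Longrightarrow> mat_of_assoc \<alpha> \<beta> M \<in> carrier_mat p q"
  by (auto simp: mat_of_assoc_def tess_mat_def)

text \<open>Dimensions are fixed through \<open>M 1\<close> because \<open>tess_mat\<close> reads
  them off there.\<close>

lemma assoc_comp_mat_of_assoc:
  assumes "\<alpha> > 0" "\<beta> > 0" "n \<in> {1..4}" and "M 1 \<in> carrier_mat p q" "l < p" "m < q"
  shows "assoc_comp \<alpha> \<beta> n (mat_of_assoc \<alpha> \<beta> M $$ (l, m)) = M n $$ (l, m)"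
  using assms assoc_comp_of_assoc[OF assms(1-3), of "\<lambda>n. M n $$ (l, m)"]
  by (simp add: mat_of_assoc_def tess_mat_def)

lemma assoc_comp_inner1_self:
  assumes "\<alpha> \<ge> 0" "\<beta> \<ge> 0" "M \<in> carrier_mat p q"
  shows "assoc_comp \<alpha> \<beta> n (inner1 \<alpha> \<beta> M M) =
    (\<Sum>m<q. \<Sum>l<p. (assoc_comp \<alpha> \<beta> n (M $$ (l, m)))\<^sup>2)"
  using assms
  by (simp add: inner1_def tmat_trace_def tmat_mult_def herm11_def assoc_comp_sum
      assoc_comp_tmult power2_eq_square)

lemma svd_trunc_carrier:
  "U \<in> carrier_mat p p' \<Longrightarrow> V \<in> carrier_mat q q' \<Longrightarrow> svd_trunc \<alpha> \<beta> U S V k \<in> carrier_mat p q"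
  by (simp add: svd_trunc_def)

lemma assoc_comp_svd_trunc:
  assumes "\<alpha> > 0" "\<beta> > 0" "n \<in> {1..4}"
    and U: "Us 1 \<in> carrier_mat p p" and S: "Ss 1 \<in> carrier_mat p q" and V: "Vs 1 \<in> carrier_mat q q"
    and "k \<le> min p q" "l < p" "m < q"
  shows "assoc_comp \<alpha> \<beta> n
      (svd_trunc \<alpha> \<beta> (mat_of_assoc \<alpha> \<beta> Us) (mat_of_assoc \<alpha> \<beta> Ss) (mat_of_assoc \<alpha> \<beta> Vs) k $$ (l, m))
    = (\<Sum>i<k. Ss n $$ (i, i) * (Us n $$ (l, i) * Vs n $$ (m, i)))"
proof -
  note [simp] = carrier_matD[OF mat_of_assoc_carrier[where M = Us, OF U]]
    carrier_matD[OF mat_of_assoc_carrier[where M = Vs, OF V]]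
  note comp = assoc_comp_mat_of_assoc[OF assms(1-3)]
  show ?thesis
    using assms
    by (auto simp: svd_trunc_def assoc_comp_sum assoc_comp_tmult tmat_mult_def col_mat_def herm11_def
        mat_of_cols_index comp[of Us p p] comp[of Ss p q] comp[of Vs q q] intro!: sum.cong)
qed

section \<open>Frobenius norms and real singular value decompositions\<close>

lemma orthonormal_mat_cols:
  assumes "orthonormal_mat n U" "i < n" "j < n"
  shows "(\<Sum>l<n. U $$ (l, i) * U $$ (l, j)) = (if i = j then 1 else 0)"
proof -
  have U: "U \<in> carrier_mat n n" and "transpose_mat U * U = 1\<^sub>m n"
    using assms by (auto simp: orthonormal_mat_def)
  then have "(transpose_mat U * U) $$ (i, j) = (if i = j then 1 else 0)"
    using assms by simp
  then show ?thesis
    using U assms by (simp add: scalar_prod_def lessThan_atLeast0)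
qed

text \<open>Parseval: the rank-one matrices formed from matching columns of \<open>U\<close> and
  \<open>V\<close> are orthonormal for the Frobenius inner product. A general index set
  \<open>I\<close> is allowed because a permuted truncation omits an arbitrary set of terms.\<close>

lemma sum_squares_orthonormal:
  assumes U: "orthonormal_mat p U" and V: "orthonormal_mat q V" and I: "I \<subseteq> {..<min p q}"
  shows "(\<Sum>m<q. \<Sum>l<p. (\<Sum>i\<in>I. c i * (U $$ (l, i) * V $$ (m, i)))\<^sup>2) = (\<Sum>i\<in>I. (c i)\<^sup>2)"
proof -
  have fin: "finite I"
    using I finite_subset by blast
  have "(\<Sum>m<q. \<Sum>l<p. (\<Sum>i\<in>I. c i * (U $$ (l, i) * V $$ (m, i)))\<^sup>2) =
    (\<Sum>m<q. \<Sum>l<p. \<Sum>i\<in>I. \<Sum>j\<in>I.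
      c i * c j * (U $$ (l, i) * U $$ (l, j)) * (V $$ (m, i) * V $$ (m, j)))"
    by (simp add: power2_eq_square sum_product mult_ac)
  also have "\<dots> = (\<Sum>i\<in>I. \<Sum>j\<in>I. \<Sum>m<q. \<Sum>l<p.
      c i * c j * (U $$ (l, i) * U $$ (l, j)) * (V $$ (m, i) * V $$ (m, j)))"
    by (simp add: sum.swap[of _ "{..<p}" I] sum.swap[of _ "{..<q}" I])
  also have "\<dots> = (\<Sum>i\<in>I. \<Sum>j\<in>I. c i * c j *
      (\<Sum>l<p. U $$ (l, i) * U $$ (l, j)) * (\<Sum>m<q. V $$ (m, i) * V $$ (m, j)))"
    by (simp add: sum_distrib_left sum_distrib_right)
  also have "\<dots> = (\<Sum>i\<in>I. \<Sum>j\<in>I. if i = j then (c i)\<^sup>2 else 0)"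
    using I by (intro sum.cong refl)
      (auto simp: orthonormal_mat_cols[OF U] orthonormal_mat_cols[OF V] power2_eq_square subset_iff)
  also have "\<dots> = (\<Sum>i\<in>I. (c i)\<^sup>2)"
    using fin by simp
  finally show ?thesis .
qed

text \<open>Zero singular values are kept in the sum, so that all four components share the range
  \<open>min p q\<close> although their ranks may differ.\<close>

lemma real_svd_index:
  assumes "real_svd p q A U S V r" "l < p" "m < q"
  shows "A $$ (l, m) = (\<Sum>i<min p q. S $$ (i, i) * (U $$ (l, i) * V $$ (m, i)))"
proof -
  have car: "U \<in> carrier_mat p p" "V \<in> carrier_mat q q" "S \<in> carrier_mat p q"
    and diag: "diagonal_mat S" and A: "A = U * S * transpose_mat V"
    using assms by (auto simp: real_svd_def orthonormal_mat_def)
  have "A $$ (l, m) = (\<Sum>j<q. (\<Sum>i<p. U $$ (l, i) * S $$ (i, j)) * V $$ (m, j))"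
    using car assms by (simp add: A scalar_prod_def lessThan_atLeast0 del: assoc_mult_mat)
  \<comment> \<open>Only the diagonal of \<open>S\<close> contributes, and a column \<open>j\<close>
    with \<open>p \<le> j\<close> has no diagonal entry.\<close>
  also have "\<dots> = (\<Sum>j<q. if j < p then S $$ (j, j) * (U $$ (l, j) * V $$ (m, j)) else 0)"
  proof (intro sum.cong refl)
    fix j assume j: "j \<in> {..<q}"
    have "(\<Sum>i<p. U $$ (l, i) * S $$ (i, j)) = (\<Sum>i<p. if i = j then U $$ (l, j) * S $$ (j, j) else 0)"
      using car diag j by (intro sum.cong refl) (auto simp: diagonal_mat_def)
    then show "(\<Sum>i<p. U $$ (l, i) * S $$ (i, j)) * V $$ (m, j) =
        (if j < p then S $$ (j, j) * (U $$ (l, j) * V $$ (m, j)) else 0)"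
      by simp
  qed
  also have "\<dots> = (\<Sum>j\<in>{..<q} \<inter> {j. j < p}. S $$ (j, j) * (U $$ (l, j) * V $$ (m, j)))"
    by (simp add: sum.inter_restrict)
  also have "{..<q} \<inter> {j. j < p} = {..<min p q}"
    by auto
  finally show ?thesis .
qed

text \<open>The error is the part of the full expansion indexed by the image of the tail under
  \<tau>, to which Parseval applies. The bound on \<open>k\<close> is \<open>min p q\<close> since
  \<open>k\<close> may exceed the rank \<open>r\<close> of this one component.\<close>

lemma real_svd_trunc_error:
  assumes svd: "real_svd p q A U S V r" and \<tau>: "\<tau> permutes {..<r}" and k: "k \<le> min p q"
  shows "(\<Sum>m<q. \<Sum>l<p. (A $$ (l, m) -
      (\<Sum>i<k. S $$ (\<tau> i, \<tau> i) * (U $$ (l, \<tau> i) * V $$ (m, \<tau> i))))\<^sup>2) =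
    (\<Sum>i=k..<min p q. (S $$ (\<tau> i, \<tau> i))\<^sup>2)"
proof -
  define N where "N = min p q"
  have UV: "orthonormal_mat p U" "orthonormal_mat q V" and "r \<le> N"
    using svd by (auto simp: real_svd_def N_def)
  then have \<tau>N: "\<tau> permutes {..<N}"
    using \<tau> by (auto intro: permutes_subset)
  have inj: "inj_on \<tau> I" for I
    using \<tau>N permutes_inj_on by blast
  have sub: "\<tau> ` {k..<N} \<subseteq> {..<N}"
    using permutes_image[OF \<tau>N] by auto
  have diff: "A $$ (l, m) - (\<Sum>i<k. S $$ (\<tau> i, \<tau> i) * (U $$ (l, \<tau> i) * V $$ (m, \<tau> i))) =
    (\<Sum>i\<in>\<tau> ` {k..<N}. S $$ (i, i) * (U $$ (l, i) * V $$ (m, i)))"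
    if "l < p" "m < q" for l m
  proof -
    let ?f = "\<lambda>i. S $$ (i, i) * (U $$ (l, i) * V $$ (m, i))"
    have "A $$ (l, m) = (\<Sum>i<N. ?f (\<tau> i))"
      using real_svd_index[OF svd that] sum.permute[OF \<tau>N, of ?f] by (simp add: N_def o_def)
    also have "{..<N} = {..<k} \<union> {k..<N}"
      using k by (auto simp: N_def)
    also have "(\<Sum>i\<in>\<dots>. ?f (\<tau> i)) = (\<Sum>i<k. ?f (\<tau> i)) + (\<Sum>i=k..<N. ?f (\<tau> i))"
      by (intro sum.union_disjoint) auto
    finally show ?thesis
      by (simp add: sum.reindex[OF inj])
  qed
  show ?thesis
    using sum_squares_orthonormal[OF UV sub[unfolded N_def], of "\<lambda>i. S $$ (i, i)"]
    by (simp add: diff sum.reindex[OF inj] N_def)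
qed

section \<open>Rearrangement of decreasing sequences\<close>

text \<open>Exchange argument: off their intersection, \<open>J\<close> and the initial segment of
  size \<open>k = card J\<close> have equally many elements. There the values on \<open>J\<close>
  are at most \<open>g k\<close>, those on the segment at least \<open>g k\<close>.\<close>

lemma sum_le_sum_initial:
  fixes g :: "nat \<Rightarrow> 'a :: linordered_idom"
  assumes anti: "\<And>i j. i \<le> j \<Longrightarrow> j < N \<Longrightarrow> g j \<le> g i" and J: "J \<subseteq> {..<N}"
  shows "sum g J \<le> sum g {..<card J}"
\<comment> \<open>The threshold \<open>g k\<close> can be compared by monotonicity only for
  \<open>k < N\<close>; otherwise \<open>J\<close> is the whole range.\<close>
proof (cases "card J < N")
  case True
  define k where "k = card J"
  have fin: "finite J"
    using J finite_subset by blast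
  have "sum g (J - {..<k}) \<le> of_nat (card (J - {..<k})) * g k"
    using J by (intro sum_bounded_above anti) auto
  also have "card (J - {..<k}) = card ({..<k} - J)"
    using fin by (simp add: card_Diff_subset_Int Int_commute k_def)
  also have "of_nat (card ({..<k} - J)) * g k \<le> sum g ({..<k} - J)"
    using True by (intro sum_bounded_below anti) (auto simp: k_def)
  finally have "sum g (J - {..<k}) + sum g (J \<inter> {..<k}) \<le>
      sum g ({..<k} - J) + sum g ({..<k} \<inter> J)"
    by (simp add: Int_commute)
  then show ?thesis
    using fin sum.Int_Diff[of J g "{..<k}"] sum.Int_Diff[of "{..<k}" g J]
    by (simp add: k_def add.commute)
next
  case False
  then have "J = {..<N}"
    using J by (intro card_seteq) auto
  then show ?thesis
    by simp
qed

text \<open>A permutation preserves the total, so the largest head leaves the smallest tail.\<close>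

lemma sum_tail_le_permuted:
  fixes g :: "nat \<Rightarrow> 'a :: linordered_idom"
  assumes anti: "\<And>i j. i \<le> j \<Longrightarrow> j < N \<Longrightarrow> g j \<le> g i" and \<tau>: "\<tau> permutes {..<N}" and "k \<le> N"
  shows "(\<Sum>i=k..<N. g i) \<le> (\<Sum>i=k..<N. g (\<tau> i))"
proof -
  have inj: "inj_on \<tau> I" for I
    using \<tau> permutes_inj_on by blast
  have "\<tau> ` {..<k} \<subseteq> {..<N}"
    using permutes_image[OF \<tau>] \<open>k \<le> N\<close> by auto
  from sum_le_sum_initial[OF anti this] have "(\<Sum>i<k. g (\<tau> i)) \<le> (\<Sum>i<k. g i)"
    by (simp add: card_image[OF inj] sum.reindex[OF inj])
  moreover have "(\<Sum>i<k. h i) + (\<Sum>i=k..<N. h i) = (\<Sum>i<N. h i)" for h :: "nat \<Rightarrow> 'a"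
    using \<open>k \<le> N\<close> sum.atLeastLessThan_concat[of 0 k N h] by (simp add: lessThan_atLeast0)
  note this[of g] this[of "\<lambda>i. g (\<tau> i)"]
  moreover have "(\<Sum>i<N. g (\<tau> i)) = (\<Sum>i<N. g i)"
    using sum.permute[OF \<tau>, of g] by (simp add: o_def)
  ultimately show ?thesis
    by linarith
qed

text \<open>Beyond the rank the entries vanish, so monotonicity extends from the first
  \<open>r\<close> positions to the whole diagonal.\<close>

lemma real_svd_sq_antimono:
  assumes "real_svd p q A U S V r" "i \<le> j" "j < min p q"
  shows "(S $$ (j, j))\<^sup>2 \<le> (S $$ (i, i))\<^sup>2"
proof (cases "j < r")
  case True
  then show ?thesis
    using assms by (intro power_mono) (auto simp: real_svd_def less_imp_le)
next
  case False
  then show ?thesis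
    using assms by (simp add: real_svd_def)
qed

text \<open>Trades the working range \<open>min p q\<close> for the maximal rank \<open>r\<close>
  used in the claims; entries from the component's own rank \<open>s\<close> onwards are
  zero.\<close>

lemma real_svd_sum_squares:
  assumes "real_svd p q A U S V s" "s \<le> r" "r \<le> min p q"
  shows "(\<Sum>i=k..<min p q. (S $$ (i, i))\<^sup>2) = (\<Sum>i=k..<r. (S $$ (i, i))\<^sup>2)"
  using assms by (intro sum.mono_neutral_right) (auto simp: real_svd_def)

section \<open>Assembly of the four claims from the components\<close>

theorem theorem4:
  fixes \<alpha> \<beta> :: real
    and p q r k :: nat
    and X U S V U' S' V' X\<^sub>k X\<^sub>k' :: "tessarine mat"
    and Us Ss Vs :: "nat \<Rightarrow> real mat"
    and rs :: "nat \<Rightarrow> nat"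
    and \<tau> :: "nat \<Rightarrow> nat \<Rightarrow> nat"
    and \<sigma> :: "nat \<Rightarrow> tessarine"
  assumes "\<alpha> > 0" and "\<beta> > 0"
    and "X \<in> carrier_mat p q"
    and "\<forall>n\<in>{1..4}. real_svd p q (assoc_part \<alpha> \<beta> X n) (Us n) (Ss n) (Vs n) (rs n)"
    and "r = Max (rs ` {1..4})"
    and "U = mat_of_assoc \<alpha> \<beta> Us"
    and "S = mat_of_assoc \<alpha> \<beta> Ss"
    and "V = mat_of_assoc \<alpha> \<beta> Vs"
    and "\<forall>n\<in>{1..4}. \<tau> n permutes {..<rs n}"
    and "U' = mat_of_assoc \<alpha> \<beta> (\<lambda>n. reorder_cols (\<tau> n) (Us n))"
    and "S' = mat_of_assoc \<alpha> \<beta> (\<lambda>n. reorder_diag (\<tau> n) (Ss n))"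
    and "V' = mat_of_assoc \<alpha> \<beta> (\<lambda>n. reorder_cols (\<tau> n) (Vs n))"
    and "\<forall>i<r. \<sigma> i = S $$ (i, i)"
    and "k \<le> r"
    and "X\<^sub>k = svd_trunc \<alpha> \<beta> U S V k"
    and "X\<^sub>k' = svd_trunc \<alpha> \<beta> U' S' V' k"
  shows "inner1 \<alpha> \<beta> X X = (\<Sum>i<r. tmult \<alpha> \<beta> (\<sigma> i) (\<sigma> i)) \<and>
    inner1 \<alpha> \<beta> (X - X\<^sub>k) (X - X\<^sub>k) = (\<Sum>i=k..<r. tmult \<alpha> \<beta> (\<sigma> i) (\<sigma> i)) \<and>
    tess_le \<alpha> \<beta> (inner1 \<alpha> \<beta> (X - X\<^sub>k) (X - X\<^sub>k)) (inner1 \<alpha> \<beta> (X - X\<^sub>k') (X - X\<^sub>k')) \<and>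
    norm1 \<alpha> \<beta> (X - X\<^sub>k) \<le> norm1 \<alpha> \<beta> (X - X\<^sub>k')"
proof -
  note ab = assms(1,2)
  have X: "X \<in> carrier_mat p q"
    by fact
  have svd: "real_svd p q (assoc_part \<alpha> \<beta> X n) (Us n) (Ss n) (Vs n) (rs n)" if "n \<in> {1..4}" for n
    using assms(4) that by blast
  have perm: "\<tau> n permutes {..<rs n}" if "n \<in> {1..4}" for n
    using assms(9) that by blast
  have rs_min: "rs n \<le> min p q" if "n \<in> {1..4}" for n
    using svd[OF that] by (simp add: real_svd_def)
  have rs_r: "rs n \<le> r" if "n \<in> {1..4}" for n
    using that unfolding assms(5) by (intro Max_ge) auto
  have r_min: "r \<le> min p q"
    unfolding assms(5) using rs_min by (subst Max_le_iff) auto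
  have k_min: "k \<le> min p q"
    using \<open>k \<le> r\<close> r_min by simp
  have car: "Us n \<in> carrier_mat p p" "Ss n \<in> carrier_mat p q" "Vs n \<in> carrier_mat q q"
    if "n \<in> {1..4}" for n
    using svd[OF that] by (auto simp: real_svd_def orthonormal_mat_def)
  have car1: "Us 1 \<in> carrier_mat p p" "Ss 1 \<in> carrier_mat p q" "Vs 1 \<in> carrier_mat q q"
    using car[of 1] by auto
  have car1': "reorder_cols (\<tau> 1) (Us 1) \<in> carrier_mat p p"
    "reorder_diag (\<tau> 1) (Ss 1) \<in> carrier_mat p q" "reorder_cols (\<tau> 1) (Vs 1) \<in> carrier_mat q q"
    using car1 by (auto simp: reorder_cols_def reorder_diag_def)
  have car_k: "X\<^sub>k \<in> carrier_mat p q" "X\<^sub>k' \<in> carrier_mat p q"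
    using assms car1 car1' by (auto intro!: svd_trunc_carrier mat_of_assoc_carrier)
  \<comment> \<open>The full norm is the truncation error for \<open>k = 0\<close> and the identity
    permutation; the ordered truncation is the identity case for general \<open>k\<close>.\<close>
  have comp_X: "assoc_comp \<alpha> \<beta> n (inner1 \<alpha> \<beta> X X) = (\<Sum>i<min p q. (Ss n $$ (i, i))\<^sup>2)"
    if "n \<in> {1..4}" for n
    using real_svd_trunc_error[OF svd[OF that] permutes_id, of 0] ab
    by (simp add: assoc_comp_inner1_self[OF _ _ X] assoc_part_index[OF X] lessThan_atLeast0)
  have comp_k: "assoc_comp \<alpha> \<beta> n (inner1 \<alpha> \<beta> (X - X\<^sub>k) (X - X\<^sub>k)) =
      (\<Sum>i=k..<min p q. (Ss n $$ (i, i))\<^sup>2)" if n: "n \<in> {1..4}" for n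
  proof -
    have "assoc_comp \<alpha> \<beta> n ((X - X\<^sub>k) $$ (l, m)) = assoc_part \<alpha> \<beta> X n $$ (l, m) -
        (\<Sum>i<k. Ss n $$ (i, i) * (Us n $$ (l, i) * Vs n $$ (m, i)))" if "l < p" "m < q" for l m
      using X car_k that assoc_comp_svd_trunc[where Us = Us and Ss = Ss and Vs = Vs, OF ab n car1 k_min that]
      by (simp add: assoc_comp_diff assoc_part_index[OF X] assms)
    then show ?thesis
      using real_svd_trunc_error[OF svd[OF n] permutes_id k_min] ab car_k
      by (simp add: assoc_comp_inner1_self[where p = p and q = q] minus_carrier_mat)
  qed
  have comp_k': "assoc_comp \<alpha> \<beta> n (inner1 \<alpha> \<beta> (X - X\<^sub>k') (X - X\<^sub>k')) =
      (\<Sum>i=k..<min p q. (Ss n $$ (\<tau> n i, \<tau> n i))\<^sup>2)" if n: "n \<in> {1..4}" for n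
  proof -
    have "assoc_comp \<alpha> \<beta> n ((X - X\<^sub>k') $$ (l, m)) = assoc_part \<alpha> \<beta> X n $$ (l, m) -
        (\<Sum>i<k. Ss n $$ (\<tau> n i, \<tau> n i) * (Us n $$ (l, \<tau> n i) * Vs n $$ (m, \<tau> n i)))"
      if "l < p" "m < q" for l m
    proof -
      have "(\<Sum>i<k. reorder_diag (\<tau> n) (Ss n) $$ (i, i) *
          (reorder_cols (\<tau> n) (Us n) $$ (l, i) * reorder_cols (\<tau> n) (Vs n) $$ (m, i))) =
        (\<Sum>i<k. Ss n $$ (\<tau> n i, \<tau> n i) * (Us n $$ (l, \<tau> n i) * Vs n $$ (m, \<tau> n i)))"
        using car[OF n] k_min that
        by (intro sum.cong refl) (auto simp: reorder_diag_def reorder_cols_def)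
      then show ?thesis
        using X car_k that
          assoc_comp_svd_trunc[where Us = "\<lambda>n. reorder_cols (\<tau> n) (Us n)" and
            Ss = "\<lambda>n. reorder_diag (\<tau> n) (Ss n)" and Vs = "\<lambda>n. reorder_cols (\<tau> n) (Vs n)",
            OF ab n car1' k_min that]
        by (simp add: assoc_comp_diff assoc_part_index[OF X] assms)
    qed
    then show ?thesis
      using real_svd_trunc_error[OF svd[OF n] perm[OF n] k_min] ab car_k
      by (simp add: assoc_comp_inner1_self[where p = p and q = q] minus_carrier_mat)
  qed
  \<comment> \<open>The lower limit \<open>j\<close> stays free: \<open>j = 0\<close> serves the
    first claim and \<open>j = k\<close> the second.\<close>
  have comp_sum: "assoc_comp \<alpha> \<beta> n (\<Sum>i=j..<r. tmult \<alpha> \<beta> (\<sigma> i) (\<sigma> i)) =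
      (\<Sum>i=j..<min p q. (Ss n $$ (i, i))\<^sup>2)" if n: "n \<in> {1..4}" for n j
  proof -
    have "assoc_comp \<alpha> \<beta> n (\<sigma> i) = Ss n $$ (i, i)" if "i < r" for i
      using assms(13) that r_min assoc_comp_mat_of_assoc[where M = Ss, OF ab n car1(2), of i i]
      by (simp add: assms(7))
    then show ?thesis
      using ab real_svd_sum_squares[OF svd[OF n] rs_r[OF n] r_min, of j]
      by (simp add: assoc_comp_sum assoc_comp_tmult power2_eq_square)
  qed
  have "inner1 \<alpha> \<beta> X X = (\<Sum>i<r. tmult \<alpha> \<beta> (\<sigma> i) (\<sigma> i))"
    using comp_X comp_sum[of _ 0] by (intro assoc_comp_eqI[OF ab]) (simp add: lessThan_atLeast0)
  moreover have "inner1 \<alpha> \<beta> (X - X\<^sub>k) (X - X\<^sub>k) = (\<Sum>i=k..<r. tmult \<alpha> \<beta> (\<sigma> i) (\<sigma> i))"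
    using comp_k comp_sum by (intro assoc_comp_eqI[OF ab]) simp
  moreover have le: "tess_le \<alpha> \<beta> (inner1 \<alpha> \<beta> (X - X\<^sub>k) (X - X\<^sub>k)) (inner1 \<alpha> \<beta> (X - X\<^sub>k') (X - X\<^sub>k'))"
    unfolding tess_le_def
  proof (rule semipositiveI[OF ab])
    fix n :: nat assume n: "n \<in> {1..4}"
    \<comment> \<open>Fixing the positions from \<open>rs n\<close> on makes \<open>\<tau> n\<close>
      a permutation of the common range, in which the tails starting at \<open>k\<close> are
      compared.\<close>
    have "\<tau> n permutes {..<min p q}"
      using perm[OF n] rs_min[OF n] by (auto intro: permutes_subset)
    from sum_tail_le_permuted[OF real_svd_sq_antimono[OF svd[OF n]] this k_min]
    show "0 \<le> assoc_comp \<alpha> \<beta> n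
        (inner1 \<alpha> \<beta> (X - X\<^sub>k') (X - X\<^sub>k') - inner1 \<alpha> \<beta> (X - X\<^sub>k) (X - X\<^sub>k))"
      by (simp add: assoc_comp_diff comp_k[OF n] comp_k'[OF n])
  qed
  moreover have "norm1 \<alpha> \<beta> (X - X\<^sub>k) \<le> norm1 \<alpha> \<beta> (X - X\<^sub>k')"
    using semipositive_imp_t_re_nonneg[OF le[unfolded tess_le_def]]
    by (simp add: norm1_def minus_tessarine_def)
  ultimately show ?thesis
    by blast
qed

end
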